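(* Let $\Omega\subseteq\mathbb{R}^N$ be Lebesgue measurable with $|\Omega|<\infty$ and $\dim_B(\infty,\Omega)=D<-N$, such that $\Omega$ is Minkowski measurable at infinity, and assume that the distance zeta function $\zeta_{\infty,\Omega}$ has a meromorphic continuation to a neighborhood of $s=D$. Then the inverted relative fractal drum $(\mathbf 0,\Phi(\Omega))$ is also Minkowski measurable and $$\mathcal M^D(\mathbf 0,\Phi(\Omega))=-\frac{N+D}{N-D}\,\mathcal M^D(\infty,\Omega).$$
   Context: $|\cdot|$ denotes the Euclidean norm of a vector in $\mathbb{R}^N$ and the $N$-dimensional Lebesgue measure of a set. For $t>0$, ${}_t\Omega:=B_t(0)^c\cap\Omega$, where $B_t(0)$ is the open Euclidean ball of radius $t$ centered at $0$. For $r\in\mathbb{R}$, the upper and lower $r$-dimensional Minkowski contents of $\Omega$ at infinity, $\overline{\mathcal M}^r(\infty,\Omega)$ and $\underline{\mathcal M}^r(\infty,\Omega)$, are the $\limsup$ and $\liminf$ of $|{}_t\Omega|/t^{N+r}$ as $t\to+\infty$; if they coincide the common value is $\mathcal M^r(\infty,\Omega)$. The upper (lower) Minkowski dimension at infinity is the infimum of all $r\in\mathbb{R}$ for which the upper (lower) $r$-dimensional content is $0$; if both coincide the common value is $\dim_B(\infty,\Omega)$. $\Omega$ is Minkowski measurable at infinity if for $D=\dim_B(\infty,\Omega)$ one has $0<\underline{\mathcal M}^D(\infty,\Omega)=\overline{\mathcal M}^D(\infty,\Omega)<\infty$. The distance zeta function at infinity is $\zeta_{\infty,\Omega}(s):=\int_{{}_T\Omega}|x|^{-s-N}\,dx$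 for a fixed $T>0$; it is holomorphic on $\{\operatorname{Re}s>D\}$, changing $T$ only adds an entire function, and meromorphic continuation means continuation from this half-plane. $\Phi(x):=x/|x|^2$ is the geometric inversion on $\mathbb{R}^N\setminus\{0\}$, and $\mathbf 0:=\{0\}$ is the singleton containing the origin. For a classical relative fractal drum $(A,\Omega')$ in $\mathbb{R}^N$, $\mathcal M^r(A,\Omega'):=\lim_{t\to0^+}|A_t\cap\Omega'|/t^{N-r}$ (if it exists), where $A_t$ is the open $t$-neighborhood of $A$ (so $\mathbf 0_t=B_t(0)$); $(A,\Omega')$ is Minkowski measurable if for some $r\in\mathbb{R}$ (necessarily its Minkowski dimension, which may be negative) this limit exists and lies in $(0,+\infty)$. *)

theory Defs
  imports "HOL-Complex_Analysis.Complex_Analysis"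
begin

text \<open>
  The ambient space \<open>\<real>\<^sup>N\<close> is a type of class \<open>euclidean_space\<close> with \<open>N = DIM('a)\<close>.
  Volumes, and hence Minkowski contents, take values in \<open>ennreal\<close>.
\<close>

definition tail :: "real \<Rightarrow> 'a::euclidean_space set \<Rightarrow> 'a set" where
  "tail t \<Omega> = - ball 0 t \<inter> \<Omega>"

definition upper_content_infty :: "'a::euclidean_space set \<Rightarrow> real \<Rightarrow> ennreal" where
  "upper_content_infty \<Omega> r =
     Limsup at_top (\<lambda>t::real. emeasure lebesgue (tail t \<Omega>) / ennreal (t powr (real DIM('a) + r)))"

definition lower_content_infty :: "'a::euclidean_space set \<Rightarrow> real \<Rightarrow> ennreal" where
  "lower_content_infty \<Omega> r =
     Liminf at_top (\<lambda>t::real. emeasure lebesgue (tail t \<Omega>) / ennreal (t powr (real DIM('a) + r)))"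

text \<open>The common value of the two contents; unspecified if they differ.\<close>

definition content_infty :: "'a::euclidean_space set \<Rightarrow> real \<Rightarrow> ennreal" where
  "content_infty \<Omega> r = (THE c. upper_content_infty \<Omega> r = c \<and> lower_content_infty \<Omega> r = c)"

text \<open>
  The infima over real exponents are taken in \<open>ereal\<close>, so that the value \<open>-\<infinity>\<close> is allowed
  for an unbounded set of exponents.
\<close>

definition upper_dim_infty :: "'a::euclidean_space set \<Rightarrow> ereal" where
  "upper_dim_infty \<Omega> = Inf (ereal ` {r. upper_content_infty \<Omega> r = 0})"

definition lower_dim_infty :: "'a::euclidean_space set \<Rightarrow> ereal" where
  "lower_dim_infty \<Omega> = Inf (ereal ` {r. lower_content_infty \<Omega> r = 0})"

definition has_dim_infty :: "'a::euclidean_space set \<Rightarrow> real \<Rightarrow> bool" where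
  "has_dim_infty \<Omega> D \<longleftrightarrow> upper_dim_infty \<Omega> = ereal D \<and> lower_dim_infty \<Omega> = ereal D"

definition minkowski_measurable_infty :: "'a::euclidean_space set \<Rightarrow> bool" where
  "minkowski_measurable_infty \<Omega> \<longleftrightarrow>
     (\<exists>D. has_dim_infty \<Omega> D \<and> 0 < lower_content_infty \<Omega> D \<and>
          lower_content_infty \<Omega> D = upper_content_infty \<Omega> D \<and> upper_content_infty \<Omega> D < \<infinity>)"

definition zeta_infty :: "real \<Rightarrow> 'a::euclidean_space set \<Rightarrow> complex \<Rightarrow> complex" where
  "zeta_infty T \<Omega> s =
     (LINT x:tail T \<Omega>|lebesgue. complex_of_real (norm x) powr (- s - of_nat DIM('a)))"

text \<open>
  The values of \<open>F\<close> at its poles are irrelevant, as \<open>meromorphic_on\<close> only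
  constrains \<open>F\<close> on punctured neighbourhoods.
\<close>

definition zeta_continues_near :: "real \<Rightarrow> 'a::euclidean_space set \<Rightarrow> real \<Rightarrow> bool" where
  "zeta_continues_near T \<Omega> D \<longleftrightarrow>
     (\<exists>U F. open U \<and> complex_of_real D \<in> U \<and> F meromorphic_on ({s. Re s > D} \<union> U) \<and>
            (\<forall>s. Re s > D \<longrightarrow> F s = zeta_infty T \<Omega> s))"

definition inversion :: "'a::euclidean_space \<Rightarrow> 'a" where
  "inversion x = x /\<^sub>R (norm x)\<^sup>2"

text \<open>The inversion is not defined at the origin, which is therefore removed before taking images.\<close>

definition inverted :: "'a::euclidean_space set \<Rightarrow> 'a set" where
  "inverted \<Omega> = inversion ` (\<Omega> - {0})"

definition nbhd :: "'a::euclidean_space set \<Rightarrow> real \<Rightarrow> 'a set" where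
  "nbhd A t = (\<Union>a\<in>A. ball a t)"

text \<open>The relative Minkowski content of \<open>(A, \<Omega>)\<close> in dimension \<open>r\<close> exists and equals \<open>c\<close>.\<close>

definition has_rel_content ::
    "'a::euclidean_space set \<Rightarrow> 'a set \<Rightarrow> real \<Rightarrow> ennreal \<Rightarrow> bool" where
  "has_rel_content A \<Omega> r c \<longleftrightarrow>
     ((\<lambda>t::real. emeasure lebesgue (nbhd A t \<inter> \<Omega>) / ennreal (t powr (real DIM('a) - r)))
        \<longlongrightarrow> c) (at_right 0)"

definition rel_minkowski_measurable :: "'a::euclidean_space set \<Rightarrow> 'a set \<Rightarrow> bool" where
  "rel_minkowski_measurable A \<Omega> \<longleftrightarrow> (\<exists>r c. has_rel_content A \<Omega> r c \<and> 0 < c \<and> c < \<infinity>)"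

end

theory Submission
  imports Defs "HOL-Real_Asymp.Real_Asymp"
begin

text \<open>
  Write \<open>N = DIM('a)\<close>, \<open>p = - (N + D)\<close> and \<open>q = N - D = 2 * N + p\<close>, and let \<open>V R\<close> be the volume
  of the part of \<open>\<Omega>\<close> outside the ball of radius \<open>R\<close>. Minkowski measurability at infinity
  says that \<open>V R * R powr p\<close> tends to a number \<open>M\<close> with \<open>0 < M < \<infinity>\<close>. The inversion carries
  that part of \<open>\<Omega>\<close> onto the part of the inverted set inside the ball of radius \<open>1 / R\<close>, whose
  volume is called \<open>G R\<close>. The claim is that \<open>G R * R powr q\<close> tends to \<open>(p / q) * M\<close>.

  The Jacobian of the inversion at \<open>x\<close> has absolute value \<open>norm x powr (- 2 * N)\<close>, so \<open>G R\<close> is the integral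
  of \<open>norm x powr (- 2 * N)\<close> over the tail, and Fubini's theorem would express it through \<open>V\<close>.
  The proof replaces this by a comparison on shells. On \<open>{x. R \<le> norm x}\<close> the inversion is
  Lipschitz with constant \<open>1 / R\<^sup>2\<close>, so it shrinks volumes there by at least the factor
  \<open>R powr (- 2 * N)\<close> (\<open>emeasure_lipschitz_image_le\<close>); as it is an involution, this also
  bounds volumes from below on \<open>{x. norm x \<le> R}\<close>. On a shell \<open>R < norm x \<le> \<kappa> * R\<close> the two
  bounds differ by the factor \<open>\<kappa> powr (2 * N)\<close> only. The shells from \<open>\<kappa> ^ k * R\<close> to
  \<open>\<kappa> ^ (k + 1) * R\<close> exhaust the tail, their volumes behave like a geometric progression, and
  summing it gives \<open>G R * R powr q\<close> asymptotically as
  \<open>M * (1 - \<kappa> powr - p) / (1 - \<kappa> powr - q)\<close> up to that factor. As \<open>\<kappa>\<close> decreases to \<open>1\<close>, the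
  quotient tends to \<open>p / q\<close> and the factor to \<open>1\<close> (\<open>tendsto_of_shell_bounds\<close>).
\<close>

section \<open>Tail asymptotics from bounds on shells\<close>

lemma tendsto_powr_quotient_at_1:
  fixes p q :: real
  assumes "p > 0" "q > 0"
  shows "((\<lambda>x::real. (1 - x powr (-p))/(1 - x powr (-q))) \<longlongrightarrow> p/q) (at_right 1)"
  using assms by real_asymp (simp add: divide_inverse)

text \<open>
  Iterating the recursion \<open>n\<close> times leaves a geometric sum and a remainder
  \<open>\<theta> ^ n * g (\<kappa> ^ n * R)\<close>, whose upper bound \<open>\<theta> ^ n * C\<close> tends to \<open>0\<close>. The value of
  \<open>C\<close> leaves no trace, so a crude bound is good enough. Working with the difference from
  the fixed point \<open>a / (1 - \<theta>)\<close> turns the geometric sum into a bare power of \<open>\<theta>\<close>.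
\<close>
lemma geometric_recursion_le:
  fixes g :: "real \<Rightarrow> real"
  assumes "\<kappa> \<ge> 1" "0 \<le> \<theta>" "\<theta> < 1" "R\<^sub>0 \<ge> 0"
    and rec: "\<And>R. R \<ge> R\<^sub>0 \<Longrightarrow> g R \<le> a + \<theta> * g (\<kappa> * R)"
    and bdd: "\<And>R. R \<ge> R\<^sub>0 \<Longrightarrow> g R \<le> C"
    and R: "R \<ge> R\<^sub>0"
  shows "g R \<le> a / (1 - \<theta>)"
proof -
  define b where "b = a / (1 - \<theta>)"
  have b: "a - b = - \<theta> * b" using \<open>\<theta> < 1\<close> by (simp add: b_def field_simps)
  have *: "g R - b \<le> \<theta> ^ n * (C - b)" if "R \<ge> R\<^sub>0" for n R
    using that
  proof (induction n arbitrary: R)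
    case 0 then show ?case using bdd[of R] by simp
  next
    case (Suc n)
    have "\<kappa> * R \<ge> R\<^sub>0"
      using mult_mono[of 1 \<kappa> R\<^sub>0 R] Suc.prems assms by auto
    then have "\<theta> * (g (\<kappa> * R) - b) \<le> \<theta> * (\<theta> ^ n * (C - b))"
      using Suc.IH \<open>0 \<le> \<theta>\<close> by (intro mult_left_mono) auto
    moreover have "g R - b \<le> \<theta> * (g (\<kappa> * R) - b)"
      using rec[OF Suc.prems] b by (simp add: algebra_simps)
    ultimately show ?case by simp
  qed
  have "(\<lambda>n. \<theta> ^ n * (C - b)) \<longlonglongrightarrow> 0 * (C - b)"
    using assms by (intro tendsto_intros LIMSEQ_realpow_zero) auto
  then have "g R - b \<le> 0"
    using LIMSEQ_le_const[of _ 0 "g R - b"] *[OF R] by auto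
  then show ?thesis by (simp add: b_def)
qed

text \<open>
  Here \<open>V R\<close> and \<open>G R\<close> stand for the masses of \<open>{x. norm x > R}\<close> under a measure \<open>\<mu>\<close> and
  under the measure with density \<open>norm x powr - m\<close> relative to \<open>\<mu>\<close>; the hypotheses bound the
  density on a shell \<open>R < norm x \<le> \<kappa> * R\<close> by its extreme values there. With \<open>q = m + p\<close>, the
  shell from \<open>R\<close> to \<open>\<kappa> * R\<close> contributes to \<open>G R * R powr q\<close>, in the limit of large \<open>R\<close>,
  between \<open>\<kappa> powr - m\<close> times and once \<open>M * (1 - \<kappa> powr - p)\<close>. The remaining part is
  \<open>\<kappa> powr - q\<close> times the same quantity at \<open>\<kappa> * R\<close>, so the geometric recursion
  divides these bounds by \<open>1 - \<kappa> powr - q\<close>. Letting \<open>\<kappa>\<close> decrease to \<open>1\<close> makes both meet at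
  \<open>M * p / q\<close>.
\<close>
lemma tendsto_of_shell_bounds:
  fixes V G :: "real \<Rightarrow> real"
  assumes p: "p > 0" and m: "m \<ge> 0" 
    and V_lim: "((\<lambda>R. V R * R powr p) \<longlongrightarrow> M) at_top"
    and lower: "\<And>R \<kappa>. \<lbrakk>R > 0; \<kappa> > 1\<rbrakk> \<Longrightarrow>
      (\<kappa> * R) powr (-m) * (V R - V (\<kappa> * R)) \<le> G R - G (\<kappa> * R)"
    and upper: "\<And>R \<kappa>. \<lbrakk>R > 0; \<kappa> > 1\<rbrakk> \<Longrightarrow>
      G R - G (\<kappa> * R) \<le> R powr (-m) * (V R - V (\<kappa> * R))"
    and nonneg: "\<And>R. R > 0 \<Longrightarrow> 0 \<le> G R"
    and bound: "\<And>R. R > 0 \<Longrightarrow> G R \<le> R powr (-m) * V R"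
  shows "((\<lambda>R. G R * R powr (m + p)) \<longlongrightarrow> p / (m + p) * M) at_top"
proof -
  define q where "q = m + p"
  have q: "q > 0" using p m by (simp add: q_def)
  define g where "g = (\<lambda>R. G R * R powr q)"
  define A where "A = (\<lambda>l::real. M * ((1 - l powr (-p)) / (1 - l powr (-q))))"
  have limA: "(A \<longlongrightarrow> M * (p / q)) (at_right 1)"
    unfolding A_def using tendsto_powr_quotient_at_1[OF p q] by (rule tendsto_mult_left)
  have scaled_lim: "((\<lambda>R. (V R - V (l * R)) * R powr p) \<longlongrightarrow> M * (1 - l powr (-p))) at_top"
    if l: "l > 1" for l
  proof -
    have "filterlim (\<lambda>R. l * R) at_top at_top"
      using l by (intro filterlim_tendsto_pos_mult_at_top[OF tendsto_const]) (auto intro: filterlim_ident)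
    then have "((\<lambda>R. V (l * R) * (l * R) powr p) \<longlongrightarrow> M) at_top"
      by (rule filterlim_compose[OF V_lim])
    then have "((\<lambda>R. V R * R powr p - l powr (-p) * (V (l * R) * (l * R) powr p))
        \<longlongrightarrow> M - l powr (-p) * M) at_top"
      by (intro tendsto_intros V_lim)
    moreover have "\<forall>\<^sub>F R in at_top. V R * R powr p - l powr (-p) * (V (l * R) * (l * R) powr p)
        = (V R - V (l * R)) * R powr p"
      using eventually_gt_at_top[of 0]
    proof eventually_elim
      case (elim R)
      have "l powr (-p) * (l * R) powr p = R powr p"
        using l elim by (simp add: powr_mult powr_minus)
      then show ?case by (simp add: algebra_simps)
    qed
    ultimately have "((\<lambda>R. (V R - V (l * R)) * R powr p) \<longlongrightarrow> M - l powr (-p) * M) at_top"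
      by (rule Lim_transform_eventually)
    then show ?thesis by (simp add: algebra_simps)
  qed
  have g_nonneg: "g R \<ge> 0" if "R > 0" for R
    using nonneg[OF that] by (simp add: g_def)
  \<comment> \<open>\<open>g R \<le> V R * R powr p\<close>, whose limit is \<open>M\<close>: this is the a priori bound for the recursion.\<close>
  have g_bdd: "\<forall>\<^sub>F R in at_top. g R \<le> M + 1"
    using order_tendstoD(2)[OF V_lim less_add_one] eventually_gt_at_top[of 0]
  proof eventually_elim
    case (elim R)
    have "g R \<le> (R powr (-m) * V R) * R powr q"
      unfolding g_def using bound[OF elim(2)] by (intro mult_right_mono) auto
    also have "\<dots> = V R * R powr p"
      using elim by (simp add: q_def powr_add powr_minus field_simps)
    finally show ?case using elim by simp
  qed
  have split: "g R = R powr q * (G R - G (l * R)) + l powr (-q) * g (l * R)"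
    if "R > 0" "l > 1" for R l
    using that by (simp add: g_def powr_mult powr_minus field_simps)
  \<comment> \<open>\<open>c * (1 - l powr - q)\<close> is chosen as the inhomogeneous term so that the fixed point is \<open>c\<close>.\<close>
  have le: "\<forall>\<^sub>F R in at_top. g R \<le> c"
    if l: "l > 1" and c: "A l < c" for l c
  proof -
    have th: "l powr (-q) < 1" using l q by (simp add: powr_less_one)
    have "\<forall>\<^sub>F R in at_top. (V R - V (l * R)) * R powr p < c * (1 - l powr (-q))"
      using c th by (intro order_tendstoD(2)[OF scaled_lim[OF l]]) (simp add: A_def field_simps)
    then have "\<forall>\<^sub>F R in at_top. R > 0 \<and> g R \<le> M + 1 \<and>
        (V R - V (l * R)) * R powr p < c * (1 - l powr (-q))"
      using g_bdd eventually_gt_at_top[of 0] by eventually_elim auto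
    then obtain R0 where R0: "\<And>R. R \<ge> R0 \<Longrightarrow> R > 0 \<and> g R \<le> M + 1 \<and>
        (V R - V (l * R)) * R powr p < c * (1 - l powr (-q))"
      by (auto simp: eventually_at_top_linorder)
    have "R0 \<ge> 0" using R0[of R0] by simp
    have "g R \<le> (c * (1 - l powr (-q))) / (1 - l powr (-q))" if "R \<ge> R0" for R
    proof (rule geometric_recursion_le[where R\<^sub>0 = R0 and \<kappa> = l and C = "M + 1" and g = g])
      fix R assume "R \<ge> R0"
      note R = R0[OF this]
      have "R powr q * (G R - G (l * R)) \<le> R powr q * (R powr (-m) * (V R - V (l * R)))"
        using upper[of R l] R l by (intro mult_left_mono) auto
      also have "\<dots> = (V R - V (l * R)) * R powr p"
        using R by (simp add: q_def powr_add powr_minus field_simps)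
      finally show "g R \<le> c * (1 - l powr (-q)) + l powr (-q) * g (l * R)"
        using split[of R l] R l by linarith
    qed (use th l \<open>R0 \<ge> 0\<close> R0 that in auto)
    then have "\<forall>R\<ge>R0. g R \<le> c" using th by simp
    then show ?thesis unfolding eventually_at_top_linorder ..
  qed
  have ge: "\<forall>\<^sub>F R in at_top. c \<le> g R"
    if l: "l > 1" and c: "c < l powr (-m) * A l" for l c
  proof -
    have th: "l powr (-q) < 1" using l q by (simp add: powr_less_one)
    have "\<forall>\<^sub>F R in at_top. l powr (-m) * ((V R - V (l * R)) * R powr p) > c * (1 - l powr (-q))"
      using c th by (intro order_tendstoD(1)[OF tendsto_mult[OF tendsto_const scaled_lim[OF l]]])
        (simp add: A_def field_simps)
    then have "\<forall>\<^sub>F R in at_top. R > 0 \<and>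
        l powr (-m) * ((V R - V (l * R)) * R powr p) > c * (1 - l powr (-q))"
      using eventually_gt_at_top[of 0] by eventually_elim auto
    then obtain R0 where R0: "\<And>R. R \<ge> R0 \<Longrightarrow> R > 0 \<and>
        l powr (-m) * ((V R - V (l * R)) * R powr p) > c * (1 - l powr (-q))"
      by (auto simp: eventually_at_top_linorder)
    have "R0 \<ge> 0" using R0[of R0] by simp
    have "- g R \<le> (- c * (1 - l powr (-q))) / (1 - l powr (-q))" if "R \<ge> R0" for R
    \<comment> \<open>The recursion lemma applied to \<open>- g\<close>, which is bounded above by \<open>0\<close>.\<close>
    proof (rule geometric_recursion_le[where R\<^sub>0 = R0 and \<kappa> = l and C = 0 and g = "\<lambda>R. - g R"])
      fix R assume "R \<ge> R0"
      note R = R0[OF this]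
      have "R powr q * (G R - G (l * R)) \<ge> R powr q * ((l * R) powr (-m) * (V R - V (l * R)))"
        using lower[of R l] R l by (intro mult_left_mono) auto
      moreover have "R powr q * ((l * R) powr (-m) * (V R - V (l * R)))
          = l powr (-m) * ((V R - V (l * R)) * R powr p)"
        using R l by (simp add: q_def powr_add powr_mult powr_minus field_simps)
      ultimately show "- g R \<le> - c * (1 - l powr (-q)) + l powr (-q) * - g (l * R)"
        using split[of R l] R l by linarith
    qed (use th l \<open>R0 \<ge> 0\<close> R0 g_nonneg that in auto)
    then have "\<forall>R\<ge>R0. c \<le> g R" using th by simp
    then show ?thesis unfolding eventually_at_top_linorder ..
  qed
  have "(g \<longlongrightarrow> M * (p / q)) at_top"
  proof (rule order_tendstoI)
    fix c assume "M * (p / q) < c"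
    then obtain c' where c': "M * (p / q) < c'" "c' < c" using dense by blast
    have "\<forall>\<^sub>F l in at_right 1. A l < c' \<and> l > 1"
      using order_tendstoD(2)[OF limA c'(1)] eventually_at_right_less by eventually_elim auto
    then obtain l where l: "A l < c'" "l > 1"
      using eventually_happens'[of "at_right (1::real)"] by fastforce
    have "l powr (-q) < 1" using l q by (simp add: powr_less_one)
    then show "\<forall>\<^sub>F R in at_top. g R < c"
      using le[OF l(2,1)] c' by (auto elim!: eventually_mono)
  next
    fix c assume "c < M * (p / q)"
    then obtain c' where c': "c < c'" "c' < M * (p / q)" using dense by blast
    have "((\<lambda>l. l powr (-m) * A l) \<longlongrightarrow> 1 powr (-m) * (M * (p / q))) (at_right 1)"
      by (intro tendsto_intros limA) auto
    then have "\<forall>\<^sub>F l in at_right 1. c' < l powr (-m) * A l"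
      using c' by (intro order_tendstoD(1)) auto
    then have "\<forall>\<^sub>F l in at_right 1. c' < l powr (-m) * A l \<and> l > 1"
      using eventually_at_right_less by eventually_elim auto
    then obtain l where l: "c' < l powr (-m) * A l" "l > 1"
      using eventually_happens'[of "at_right (1::real)"] by fastforce
    have "l powr (-q) < 1" using l q by (simp add: powr_less_one)
    then show "\<forall>\<^sub>F R in at_top. c < g R"
      using ge[OF l(2,1)] c' by (auto elim!: eventually_mono)
  qed
  then show ?thesis by (simp add: g_def q_def mult.commute)
qed

section \<open>Volumes of Lipschitz images\<close>

lemma lipschitz_on_imp_negligible_image:
  fixes f :: "'a::euclidean_space \<Rightarrow> 'a"
  assumes "L-lipschitz_on S f" "negligible T" "T \<subseteq> S"
  shows "negligible (f ` T)"
proof (rule negligible_locally_Lipschitz_image[OF order_refl assms(2)])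
  fix x assume "x \<in> T"
  then show "\<exists>U B. open U \<and> x \<in> U \<and> (\<forall>y \<in> T \<inter> U. norm (f y - f x) \<le> B * norm (y - x))"
    using assms lipschitz_onD[OF assms(1)]
    by (intro exI[of _ UNIV] exI[of _ L]) (auto simp: dist_norm subset_eq)
qed

lemma lipschitz_on_imp_sets_lebesgue_image:
  fixes f :: "'a::euclidean_space \<Rightarrow> 'a"
  assumes "L-lipschitz_on S f" "S \<in> sets lebesgue"
  shows "f ` S \<in> sets lebesgue"
  using sets_lebesgue_continuous_image[OF assms(2) lipschitz_on_continuous_on[OF assms(1)]]
    lipschitz_on_imp_negligible_image[OF assms(1)] by blast

text \<open>
  For a ball with centre in \<open>S\<close> the bound is clear, as the image of its trace on \<open>S\<close> lies in a
  ball of \<open>L\<close> times the radius. By Vitali's covering theorem \<open>S\<close> is, up to a negligible set,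
  covered by disjoint balls of this kind inside any given open \<open>U \<supseteq> S\<close>; disjointness is what
  keeps the constant at exactly \<open>L ^ DIM('a)\<close>. Outer regularity then replaces \<open>U\<close> by \<open>S\<close>.
\<close>
lemma emeasure_lipschitz_image_le:
  fixes f :: "'a::euclidean_space \<Rightarrow> 'a"
  assumes lip: "L-lipschitz_on S f" and S: "S \<in> sets lebesgue"
  shows "emeasure lebesgue (f ` S) \<le> ennreal (L ^ DIM('a)) * emeasure lebesgue S"
proof -
  let ?N = "DIM('a)"
  have L: "L \<ge> 0" using lip by (rule lipschitz_on_nonneg)
  have open_bound: "emeasure lebesgue (f ` S) \<le> ennreal (L ^ ?N) * emeasure lebesgue U"
    if U: "open U" "S \<subseteq> U" for U
  proof -
    define K where "K = {i. fst i \<in> S \<and> 0 < snd i \<and> ball (fst i) (snd i) \<subseteq> U}"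
    have fine: "\<exists>i. i \<in> K \<and> x \<in> ball (fst i) (snd i) \<and> snd i < d" if "x \<in> S" "0 < d" for x d
    proof -
      obtain e where e: "e > 0" "ball x e \<subseteq> U"
        using U \<open>x \<in> S\<close> openE by blast
      have "ball x (min e (d/2)) \<subseteq> ball x e" by auto
      then show ?thesis using e that
        by (intro exI[of _ "(x, min e (d / 2))"]) (auto simp: K_def)
    qed
    obtain C where C: "countable C" "C \<subseteq> K"
      and disj: "pairwise (\<lambda>i j. disjnt (ball (fst i) (snd i)) (ball (fst j) (snd j))) C"
      and neg: "negligible (S - (\<Union>i\<in>C. ball (fst i) (snd i)))"
      using Vitali_covering_theorem_balls[of S K fst snd, OF fine] by blast
    \<comment> \<open>The countable family is enumerated by a set \<open>D\<close> of naturals and padded with empty sets,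
      so that countable additivity applies also when the family is finite.\<close>
    define D where "D = to_nat_on C ` C"
    define B where "B = (\<lambda>n. if n \<in> D then
      ball (fst (from_nat_into C n)) (snd (from_nat_into C n)) else {})"
    define B' where "B' = (\<lambda>n. if n \<in> D then
      cball (f (fst (from_nat_into C n))) (L * snd (from_nat_into C n)) else {})"
    have D: "from_nat_into C n \<in> C" "from_nat_into C n \<in> K" if "n \<in> D" for n
      using that C by (auto simp: D_def)
    have UB: "(\<Union>i\<in>C. ball (fst i) (snd i)) = (\<Union>n. B n)"
      using C(1) by (force simp: B_def D_def split: if_splits)
    have N: "f ` (S - (\<Union>n. B n)) \<in> null_sets lebesgue"
      using lipschitz_on_imp_negligible_image[OF lip neg]
      by (auto simp: UB negligible_iff_null_sets)
    have B'_meas: "(\<Union>n. B' n) \<in> sets lebesgue"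
      by (intro sets.countable_UN) (auto simp: B'_def)
    have "f x \<in> B' n" if "x \<in> S" "x \<in> B n" for x n
    proof -
      let ?i = "from_nat_into C n"
      have n: "n \<in> D" "dist (fst ?i) x \<le> snd ?i"
        using that by (auto simp: B_def split: if_splits)
      have "fst ?i \<in> S" using D n by (auto simp: K_def)
      then have "dist (f (fst ?i)) (f x) \<le> L * dist (fst ?i) x"
        using lipschitz_onD[OF lip _ \<open>x \<in> S\<close>] by blast
      also have "\<dots> \<le> L * snd ?i" using n L by (intro mult_left_mono) auto
      finally show ?thesis using n by (simp add: B'_def)
    qed
    then have "f ` S \<subseteq> (\<Union>n. B' n) \<union> f ` (S - (\<Union>n. B n))"
      by blast
    then have "emeasure lebesgue (f ` S) \<le> emeasure lebesgue ((\<Union>n. B' n) \<union> f ` (S - (\<Union>n. B n)))"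
      using B'_meas N by (intro emeasure_mono) auto
    also have "\<dots> = emeasure lebesgue (\<Union>n. B' n)"
      using B'_meas N by (rule emeasure_Un_null_set)
    also have "\<dots> \<le> (\<Sum>n. emeasure lebesgue (B' n))"
      by (intro emeasure_subadditive_countably) (auto simp: B'_def)
    also have "\<dots> = (\<Sum>n. ennreal (L ^ ?N) * emeasure lebesgue (B n))"
    proof (rule suminf_cong)
      fix n
      show "emeasure lebesgue (B' n) = ennreal (L ^ ?N) * emeasure lebesgue (B n)"
      proof (cases "n \<in> D")
        case True
        then have "0 < snd (from_nat_into C n)" using D by (auto simp: K_def)
        with True L show ?thesis
          by (simp add: B'_def B_def emeasure_cball emeasure_ball power_mult_distrib
            ennreal_mult' [symmetric] mult_ac)
      qed (simp add: B_def B'_def)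
    qed
    also have "\<dots> = ennreal (L ^ ?N) * (\<Sum>n. emeasure lebesgue (B n))"
      by (rule ennreal_suminf_cmult)
    also have "(\<Sum>n. emeasure lebesgue (B n)) = emeasure lebesgue (\<Union>n. B n)"
    proof (rule suminf_emeasure)
      have "from_nat_into C m \<noteq> from_nat_into C n" if "m \<in> D" "n \<in> D" "m \<noteq> n" for m n
        using that C(1) by (auto simp: D_def)
      then show "disjoint_family B"
        using disj D by (auto simp: B_def disjoint_family_on_def pairwise_def disjnt_def)
    qed (auto simp: B_def)
    also have "\<dots> \<le> emeasure lebesgue U"
      using C U unfolding UB[symmetric] by (intro emeasure_mono) (auto simp: K_def)
    finally show ?thesis
      by (simp add: mult_left_mono)
  qed
  show ?thesis
  proof (rule ennreal_le_epsilon)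
    fix e :: real assume "0 < e"
    \<comment> \<open>The summand \<open>1\<close> in the denominator covers \<open>L = 0\<close>.\<close>
    define d where "d = e / (L ^ ?N + 1)"
    have "L ^ ?N + 1 > 0" using L by (simp add: add_nonneg_pos)
    then have d: "d > 0" "L ^ ?N * d \<le> e"
      using \<open>0 < e\<close> by (simp_all add: d_def pos_divide_le_eq mult.commute[of e])
    obtain U where U: "open U" "S \<subseteq> U" "emeasure lebesgue (U - S) < ennreal d"
      using sets_lebesgue_outer_open[OF S d(1)] by metis
    have "emeasure lebesgue U = emeasure lebesgue S + emeasure lebesgue (U - S)"
      using U S by (subst plus_emeasure) (auto simp: Un_absorb1)
    also have "\<dots> \<le> emeasure lebesgue S + ennreal d"
      using U by (intro add_left_mono) auto
    finally have "ennreal (L ^ ?N) * emeasure lebesgue U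
        \<le> ennreal (L ^ ?N) * (emeasure lebesgue S + ennreal d)"
      by (rule mult_left_mono) auto
    also have "\<dots> = ennreal (L ^ ?N) * emeasure lebesgue S + ennreal (L ^ ?N * d)"
      using L d by (simp add: distrib_left ennreal_mult')
    also have "\<dots> \<le> ennreal (L ^ ?N) * emeasure lebesgue S + ennreal e"
      using d by (intro add_left_mono ennreal_leI) 
    finally show "emeasure lebesgue (f ` S) \<le> ennreal (L ^ ?N) * emeasure lebesgue S + ennreal e"
      using open_bound[OF U(1,2)] by (rule order.trans[rotated])
  qed
qed

section \<open>Volumes under the inversion\<close>

lemma norm_inversion: "norm (inversion x) = 1 / norm x"
  by (simp add: inversion_def power2_eq_square field_simps)

lemma inversion_inversion [simp]: "inversion (inversion x) = x"
  by (cases "x = 0") (simp_all add: inversion_def power2_eq_square field_simps)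

lemma dist_inversion:
  assumes "x \<noteq> 0" "y \<noteq> 0"
  shows "dist (inversion x) (inversion y) = dist x y / (norm x * norm y)"
proof -
  have "(dist (inversion x) (inversion y))\<^sup>2 = (dist x y / (norm x * norm y))\<^sup>2"
    using assms
    by (simp add: dist_norm power2_norm_eq_inner inversion_def inner_diff field_simps
        inner_commute)
  then show ?thesis by simp
qed

lemma lipschitz_on_inversion:
  assumes "R > 0" "\<And>x. x \<in> S \<Longrightarrow> R \<le> norm x"
  shows "(1 / R\<^sup>2)-lipschitz_on S inversion"
proof (rule lipschitz_onI)
  fix x y assume xy: "x \<in> S" "y \<in> S"
  have "R\<^sup>2 \<le> norm x * norm y" unfolding power2_eq_square
    using xy assms by (intro mult_mono) auto
  moreover have "x \<noteq> 0" "y \<noteq> 0" using assms xy by force+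
  ultimately show "dist (inversion x) (inversion y) \<le> 1 / R\<^sup>2 * dist x y"
    using assms by (simp add: dist_inversion divide_left_mono)
qed (use assms in auto)

lemma inj_inversion: "inj inversion"
  by (rule injI) (metis inversion_inversion)

lemma sets_lebesgue_inversion_image:
  assumes "S \<in> sets lebesgue" "R > 0" "\<And>x. x \<in> S \<Longrightarrow> R \<le> norm x"
  shows "inversion ` S \<in> sets lebesgue"
  using lipschitz_on_imp_sets_lebesgue_image[OF lipschitz_on_inversion[OF assms(2,3)] assms(1)] .

lemma emeasure_inversion_le:
  fixes S :: "'a::euclidean_space set"
  assumes "S \<in> sets lebesgue" "R > 0" "\<And>x. x \<in> S \<Longrightarrow> R \<le> norm x"
  shows "emeasure lebesgue (inversion ` S)
    \<le> ennreal (R powr - (2 * real DIM('a))) * emeasure lebesgue S"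
proof -
  have "(1 / R\<^sup>2) ^ DIM('a) = R powr - (2 * real DIM('a))"
    using \<open>R > 0\<close> powr_realpow[of R "2 * DIM('a)"]
    by (simp add: powr_minus power_divide power_mult inverse_eq_divide)
  then show ?thesis
    using emeasure_lipschitz_image_le[OF lipschitz_on_inversion[OF assms(2,3)] assms(1)] by simp
qed

text \<open>
  The inversion is its own inverse, so the lower bound is the upper bound for the image set,
  which lies outside the ball of radius \<open>1 / R\<close>.
\<close>
lemma emeasure_inversion_ge:
  fixes S :: "'a::euclidean_space set"
  assumes S: "S \<in> sets lebesgue" "r > 0" "\<And>x. x \<in> S \<Longrightarrow> r \<le> norm x"
    and R: "\<And>x. x \<in> S \<Longrightarrow> norm x \<le> R" "r \<le> R"
  shows "ennreal (R powr - (2 * real DIM('a))) * emeasure lebesgue S \<le> emeasure lebesgue (inversion ` S)"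
proof -
  let ?m = "2 * real DIM('a)"
  have "R > 0" using R S by linarith
  have "emeasure lebesgue (inversion ` inversion ` S)
      \<le> ennreal ((1 / R) powr - ?m) * emeasure lebesgue (inversion ` S)"
    using \<open>R > 0\<close> S R
    by (intro emeasure_inversion_le sets_lebesgue_inversion_image[OF S])
       (force simp: norm_inversion intro!: frac_le)+
  then have "ennreal (R powr - ?m) * emeasure lebesgue S
      \<le> ennreal (R powr - ?m) * (ennreal ((1 / R) powr - ?m) * emeasure lebesgue (inversion ` S))"
    by (intro mult_left_mono) (auto simp: image_image)
  also have "\<dots> = ennreal (R powr - ?m * (1 / R) powr - ?m) * emeasure lebesgue (inversion ` S)"
    by (simp add: ennreal_mult' mult_ac)
  also have "R powr - ?m * (1 / R) powr - ?m = 1"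
    using \<open>R > 0\<close> by (simp add: powr_divide)
  finally show ?thesis by simp
qed

section \<open>Minkowski contents of the inverted set\<close>

text \<open>
  Open balls around the origin correspond under the inversion to complements of closed balls,
  whereas the tail keeps the bounding sphere; that sphere is negligible.
\<close>
lemma emeasure_tail:
  fixes \<Omega> :: "'a::euclidean_space set"
  assumes "\<Omega> \<in> sets lebesgue"
  shows "emeasure lebesgue (tail t \<Omega>) = emeasure lebesgue (\<Omega> - cball 0 t)"
proof -
  have "\<Omega> \<inter> sphere 0 t \<in> null_sets lebesgue"
    using negligible_sphere[of 0 t] negligible_iff_null_sets negligible_Int by blast
  moreover have "tail t \<Omega> = (\<Omega> - cball 0 t) \<union> (\<Omega> \<inter> sphere 0 t)"
    by (auto simp: tail_def)
  ultimately show ?thesis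
    using assms by (metis emeasure_Un_null_set borel_closed closed_cball sets.Diff sets_completionI_sets sets_lborel)
qed

lemma nbhd_origin_Int_inverted:
  assumes "t > 0"
  shows "nbhd {0} t \<inter> inverted \<Omega> = inversion ` (\<Omega> - cball 0 (1 / t))"
proof -
  have "nbhd {0} t \<inter> inverted \<Omega> = inversion ` {x \<in> \<Omega> - {0}. norm (inversion x) < t}"
    by (auto simp: nbhd_def inverted_def)
  also have "{x \<in> \<Omega> - {0}. norm (inversion x) < t} = \<Omega> - cball 0 (1 / t)"
  proof (rule set_eqI)
    fix x :: 'a
    have "x \<noteq> 0 \<and> norm (inversion x) < t \<longleftrightarrow> 1 / t < norm x"
      using assms by (cases "x = 0") (simp_all add: norm_inversion field_simps)
    then show "x \<in> {x \<in> \<Omega> - {0}. norm (inversion x) < t} \<longleftrightarrow> x \<in> \<Omega> - cball 0 (1 / t)"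
      by (metis (mono_tags, lifting) Diff_iff mem_Collect_eq mem_cball_0 not_le singleton_iff)
  qed
  finally show ?thesis .
qed

text \<open>
  Real-valued form of the theorem, in the radius \<open>R = 1 / t\<close>. Finiteness of the measure of
  \<open>\<Omega>\<close> lets the shells be written as differences of tails.
\<close>
lemma inverted_content_tendsto:
  fixes \<Omega> :: "'a::euclidean_space set"
  assumes \<Omega>: "\<Omega> \<in> lmeasurable" and p: "p > 0"
    and lim: "((\<lambda>R. measure lebesgue (\<Omega> - cball 0 R) * R powr p) \<longlongrightarrow> M) at_top"
  defines "q \<equiv> 2 * real DIM('a) + p"
  shows "((\<lambda>R. measure lebesgue (inversion ` (\<Omega> - cball 0 R)) * R powr q) \<longlongrightarrow> p / q * M) at_top"
proof -
  let ?m = "2 * real DIM('a)"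
  have meas: "\<Omega> - cball 0 R \<in> lmeasurable" for R
    using \<Omega> by (simp add: fmeasurable_Diff)
  have sub: "inversion ` S \<in> lmeasurable" "measure lebesgue (inversion ` S) \<le> R powr (-?m) * measure lebesgue S"
    if "S \<in> lmeasurable" "R > 0" "\<And>x. x \<in> S \<Longrightarrow> R \<le> norm x" for R and S :: "'a set"
  proof -
    have le: "emeasure lebesgue (inversion ` S) \<le> ennreal (R powr (-?m) * measure lebesgue S)"
      using emeasure_inversion_le[of S R] that
      by (simp add: fmeasurableD ennreal_mult' emeasure_eq_measure2)
    then show L: "inversion ` S \<in> lmeasurable"
      using sets_lebesgue_inversion_image[of S R] that
      by (intro fmeasurableI) (auto simp: fmeasurableD intro: le_less_trans)
    show "measure lebesgue (inversion ` S) \<le> R powr (-?m) * measure lebesgue S"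
      using le L by (simp add: emeasure_eq_measure2)
  qed
  have sup: "R powr (-?m) * measure lebesgue S \<le> measure lebesgue (inversion ` S)"
    if "S \<in> lmeasurable" "0 < r" "r \<le> R" "\<And>x. x \<in> S \<Longrightarrow> r \<le> norm x" "\<And>x. x \<in> S \<Longrightarrow> norm x \<le> R"
    for r R and S :: "'a set"
    using emeasure_inversion_ge[of S r R] that sub(1)[of S r]
    by (simp add: fmeasurableD emeasure_eq_measure2 flip: ennreal_mult')
  have shell: "\<Omega> \<inter> cball 0 (l * R) - cball 0 R \<in> lmeasurable"
    "measure lebesgue (\<Omega> - cball 0 R) - measure lebesgue (\<Omega> - cball 0 (l * R))
      = measure lebesgue (\<Omega> \<inter> cball 0 (l * R) - cball 0 R)"
    "measure lebesgue (inversion ` (\<Omega> - cball 0 R)) - measure lebesgue (inversion ` (\<Omega> - cball 0 (l * R)))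
      = measure lebesgue (inversion ` (\<Omega> \<inter> cball 0 (l * R) - cball 0 R))"
    if "R > 0" "l > 1" for R l
  proof -
    let ?S = "\<Omega> \<inter> cball 0 (l * R) - cball 0 R" and ?T = "\<Omega> - cball 0 (l * R)"
    have "R \<le> l * R" using that by simp
    have U: "\<Omega> - cball 0 R = ?S \<union> ?T" "?S \<inter> ?T = {}"
      using \<open>R \<le> l * R\<close> by auto
    show S: "?S \<in> lmeasurable" using \<Omega> by (simp add: fmeasurable_Diff fmeasurable_Int_fmeasurable)
    show "measure lebesgue (\<Omega> - cball 0 R) - measure lebesgue ?T = measure lebesgue ?S"
      unfolding U(1) using S meas[of "l * R"] U(2) by (subst measure_Un2) (auto simp: Diff_triv Int_commute)
    have "inversion ` ?S \<in> lmeasurable" "inversion ` ?T \<in> lmeasurable"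
      using sub(1)[of ?S R] sub(1)[of ?T R] S meas[of "l * R"] that \<open>R \<le> l * R\<close> by auto
    moreover have "inversion ` ?S \<inter> inversion ` ?T = {}"
      using U(2) by (simp add: inj_inversion flip: image_Int)
    ultimately show "measure lebesgue (inversion ` (\<Omega> - cball 0 R)) - measure lebesgue (inversion ` ?T)
      = measure lebesgue (inversion ` ?S)"
      unfolding U(1) image_Un by (subst measure_Un2) (auto simp: Diff_triv Int_commute)
  qed
  show ?thesis
    unfolding q_def
  proof (rule tendsto_of_shell_bounds[OF p _ lim])
    fix R l :: real assume Rl: "R > 0" "l > 1"
    note s = shell[OF Rl]
    show "(l * R) powr (-?m) * (measure lebesgue (\<Omega> - cball 0 R) - measure lebesgue (\<Omega> - cball 0 (l * R)))
       \<le> measure lebesgue (inversion ` (\<Omega> - cball 0 R)) - measure lebesgue (inversion ` (\<Omega> - cball 0 (l * R)))"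
      unfolding s(2,3) using Rl by (intro sup[OF s(1), of R]) auto
    show "measure lebesgue (inversion ` (\<Omega> - cball 0 R)) - measure lebesgue (inversion ` (\<Omega> - cball 0 (l * R)))
      \<le> R powr (-?m) * (measure lebesgue (\<Omega> - cball 0 R) - measure lebesgue (\<Omega> - cball 0 (l * R)))"
      unfolding s(2,3) using Rl by (intro sub[OF s(1)]) auto
  next
    fix R :: real assume "R > 0"
    then show "measure lebesgue (inversion ` (\<Omega> - cball 0 R)) \<le> R powr (-?m) * measure lebesgue (\<Omega> - cball 0 R)"
      by (intro sub meas) auto
  qed auto
qed

theorem theorem3p10:
  fixes \<Omega> :: "'a::euclidean_space set" and D T :: real
  assumes "\<Omega> \<in> sets lebesgue"
    and "emeasure lebesgue \<Omega> < \<infinity>"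
    and "has_dim_infty \<Omega> D"
    and "D < - real DIM('a)"
    and "minkowski_measurable_infty \<Omega>"
    and "T > 0"
    and "zeta_continues_near T \<Omega> D"
  shows "rel_minkowski_measurable {0} (inverted \<Omega>) \<and>
    has_rel_content {0} (inverted \<Omega>) D
      (ennreal (- ((real DIM('a) + D) / (real DIM('a) - D))) * content_infty \<Omega> D)"
proof -
  let ?N = "real DIM('a)"
  define p where "p = - (?N + D)"
  define q where "q = ?N - D"
  have pq: "p > 0" "q > 0" "q = 2 * ?N + p"
    using assms(4) by (auto simp: p_def q_def)
  have ratio: "- ((?N + D) / q) = p / q"
    unfolding p_def by (rule minus_divide_left)
  have \<Omega>: "\<Omega> \<in> lmeasurable"
    using assms(1,2) by (intro fmeasurableI) auto
  define f where "f = (\<lambda>t. emeasure lebesgue (tail t \<Omega>) / ennreal (t powr (?N + D)))"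
  obtain D' where "has_dim_infty \<Omega> D'" "0 < lower_content_infty \<Omega> D'"
    "lower_content_infty \<Omega> D' = upper_content_infty \<Omega> D'" "upper_content_infty \<Omega> D' < \<infinity>"
    using assms(5) by (auto simp: minkowski_measurable_infty_def)
  moreover have "D' = D"
    using \<open>has_dim_infty \<Omega> D'\<close> assms(3) by (simp add: has_dim_infty_def)
  ultimately obtain M where M: "M > 0" "upper_content_infty \<Omega> D = ennreal M"
    "lower_content_infty \<Omega> D = ennreal M"
    by (cases "upper_content_infty \<Omega> D" rule: ennreal_cases) auto
  then have content: "content_infty \<Omega> D = ennreal M"
    by (simp add: content_infty_def)
  have "(f \<longlongrightarrow> ennreal M) at_top"
    using M by (simp add: tendsto_iff_Liminf_eq_Limsup f_def upper_content_infty_def lower_content_infty_def)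
  moreover have "\<forall>\<^sub>F t in at_top. f t = ennreal (measure lebesgue (\<Omega> - cball 0 t) * t powr p)"
    using eventually_gt_at_top[of 0]
  proof eventually_elim
    case (elim t)
    then show ?case
      using \<Omega> unfolding f_def emeasure_tail[OF assms(1)]
      by (simp add: emeasure_eq_measure2 fmeasurable_Diff divide_ennreal p_def powr_minus powr_diff powr_add field_simps)
  qed
  ultimately have "((\<lambda>t. ennreal (measure lebesgue (\<Omega> - cball 0 t) * t powr p)) \<longlongrightarrow> ennreal M) at_top"
    by (simp cong: tendsto_cong)
  then have "((\<lambda>t. measure lebesgue (\<Omega> - cball 0 t) * t powr p) \<longlongrightarrow> M) at_top"
    using M by (intro tendsto_ennrealD) auto
  from inverted_content_tendsto[OF \<Omega> \<open>p > 0\<close> this]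
  have "((\<lambda>R. measure lebesgue (inversion ` (\<Omega> - cball 0 R)) * R powr q) \<longlongrightarrow> p / q * M) at_top"
    by (simp add: pq)
  moreover have "filterlim (\<lambda>t::real. 1 / t) at_top (at_right 0)"
    using filterlim_inverse_at_top_right by (simp add: inverse_eq_divide)
  ultimately have "((\<lambda>t. measure lebesgue (inversion ` (\<Omega> - cball 0 (1 / t))) * (1 / t) powr q)
      \<longlongrightarrow> p / q * M) (at_right 0)"
    by (rule filterlim_compose)
  then have "((\<lambda>t. ennreal (measure lebesgue (inversion ` (\<Omega> - cball 0 (1 / t))) * (1 / t) powr q))
      \<longlongrightarrow> ennreal (p / q * M)) (at_right 0)"
    by (rule tendsto_ennrealI)
  moreover have "\<forall>\<^sub>F t in at_right 0.
      ennreal (measure lebesgue (inversion ` (\<Omega> - cball 0 (1 / t))) * (1 / t) powr q) =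
      emeasure lebesgue (nbhd {0} t \<inter> inverted \<Omega>) / ennreal (t powr q)"
    using eventually_at_right_less
  proof eventually_elim
    case (elim t)
    have "emeasure lebesgue (inversion ` (\<Omega> - cball 0 (1 / t))) \<le>
        ennreal ((1 / t) powr - (2 * ?N)) * emeasure lebesgue (\<Omega> - cball 0 (1 / t))"
      using elim assms(1) by (intro emeasure_inversion_le) auto
    also have "\<dots> < \<infinity>"
      using \<Omega> by (simp add: emeasure_eq_measure2 fmeasurable_Diff ennreal_mult_less_top)
    finally show ?case
      using elim by (simp add: nbhd_origin_Int_inverted emeasure_eq_ennreal_measure divide_ennreal powr_divide)
  qed
  ultimately have rel_content: "has_rel_content {0} (inverted \<Omega>) D (ennreal (p / q * M))"
    unfolding has_rel_content_def q_def[symmetric] by (rule Lim_transform_eventually)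
  moreover have "0 < ennreal (p / q * M)" "ennreal (p / q * M) < \<infinity>"
    using pq M by auto
  ultimately have "rel_minkowski_measurable {0} (inverted \<Omega>)"
    unfolding rel_minkowski_measurable_def by blast
  moreover have "ennreal (p / q) * ennreal M = ennreal (p / q * M)"
    using pq by (intro ennreal_mult'[symmetric]) simp
  ultimately show ?thesis
    using rel_content unfolding content q_def[symmetric] ratio by simp
qed

end
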